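(* Let $(S,+,\cdot)$ be a semiring and let $(R,\cdot)$ be a subsemigroup of $(S,\cdot)$ such that $R$ is an $\mathrm{IP}_0$ set in $(S,+)$. If $A \subseteq R$ is piecewise syndetic in $(R,\cdot)$, then $A$ is an $\mathrm{IP}_0$ set in $(S,+)$.
   Context: A semiring $(S,+,\cdot)$ is a set with two binary operations such that $(S,+)$ is a commutative semigroup, $(S,\cdot)$ is a semigroup (not necessarily commutative), and both distributive laws hold. For $B \subseteq S$: $B$ is an $\mathrm{IP}_r$ set in $(S,+)$ if there exist $s_1,\dots,s_r \in S$ such that $\sum_{i\in\alpha} s_i \in B$ for every nonempty $\alpha \subseteq \{1,\dots,r\}$; $B$ is an $\mathrm{IP}_0$ set if it is an $\mathrm{IP}_r$ set for every $r \in \mathbb{N}$. For $r \in R$ and $B \subseteq R$, let $r^{-1}B = \{t \in R : rt \in B\}$. A set $B \subseteq R$ is thick in $(R,\cdot)$ if for every finite $F \subseteq R$ there is $x \in R$ with $Fx \subseteq B$, and piecewise syndetic in $(R,\cdot)$ if there exist $r_1,\dots,r_k \in R$ such that $r_1^{-1}B \cup \dots \cup r_k^{-1}B$ is thick in $(R,\cdot)$. *)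

theory Defs
  imports Main
begin

text \<open>
  The class \<^class>\<open>semiring\<close> asks for exactly a commutative additive semigroup, a multiplicative
  semigroup and both distributive laws; there need be neither a zero nor a one. Hence \<^const>\<open>sum\<close>,
  which needs a neutral element, is unavailable, and sums over nonempty finite index sets are
  formed by folding the remaining summands into the one with least index. The lemmas
  below show that the choice of the starting index is irrelevant, and that \<^const>\<open>sum\<close> is
  recovered when there is a zero.
\<close>

definition nesum :: "(nat \<Rightarrow> 'a::ab_semigroup_add) \<Rightarrow> nat set \<Rightarrow> 'a" where
  "nesum s I = Finite_Set.fold (\<lambda>i a. s i + a) (s (Min I)) (I - {Min I})"

lemma comp_fun_commute_plus_left:
  fixes s :: "nat \<Rightarrow> 'a::ab_semigroup_add"
  shows "comp_fun_commute (\<lambda>i a. s i + a)"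
  by unfold_locales (simp add: fun_eq_iff add.left_commute)

lemma nesum_singleton [simp]: "nesum s {i} = s i"
  by (simp add: nesum_def)

lemma nesum_insert:
  fixes s :: "nat \<Rightarrow> 'a::ab_semigroup_add"
  assumes "finite I" "I \<noteq> {}" "j \<notin> I"
  shows "nesum s (insert j I) = s j + nesum s I"
proof -
  interpret comp_fun_commute "\<lambda>i (a::'a). s i + a"
    by (rule comp_fun_commute_plus_left)
  let ?f = "\<lambda>i (a::'a). s i + a"
  let ?m = "Min I"
  have m: "?m \<in> I" using assms by simp
  have I: "I = insert ?m (I - {?m})" using m by blast
  have jm: "j \<noteq> ?m" using m assms(3) by blast
  show ?thesis
  proof (cases "j < ?m")
    case True
    then have "Min (insert j I) = j"
      by (metis Min_insert assms(1,2) less_imp_le min.absorb1)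
    then have "nesum s (insert j I) = Finite_Set.fold ?f (s j) I"
      using assms(3) by (simp add: nesum_def)
    also have "\<dots> = Finite_Set.fold ?f (s j) (insert ?m (I - {?m}))"
      using I by simp
    also have "\<dots> = s ?m + Finite_Set.fold ?f (s j) (I - {?m})"
      by (rule fold_insert) (use assms in auto)
    also have "\<dots> = Finite_Set.fold ?f (s ?m + s j) (I - {?m})"
      using fold_fun_left_comm[of "I - {?m}" ?m "s j"] assms by simp
    also have "\<dots> = Finite_Set.fold ?f (s j + s ?m) (I - {?m})"
      by (simp add: add.commute)
    also have "\<dots> = s j + nesum s I"
      using fold_fun_left_comm[of "I - {?m}" j "s ?m"] assms by (simp add: nesum_def)
    finally show ?thesis .
  next
    case False
    then have "Min (insert j I) = ?m"
      by (metis Min_insert assms(1,2) not_less min.absorb2)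
    moreover have "insert j I - {?m} = insert j (I - {?m})" using jm by blast
    ultimately have "nesum s (insert j I) = Finite_Set.fold ?f (s ?m) (insert j (I - {?m}))"
      by (simp add: nesum_def)
    also have "\<dots> = s j + nesum s I"
      unfolding nesum_def by (rule fold_insert) (use assms in auto)
    finally show ?thesis .
  qed
qed

lemma nesum_eq_sum:
  fixes s :: "nat \<Rightarrow> 'a::comm_monoid_add"
  assumes "finite I" "I \<noteq> {}"
  shows "nesum s I = sum s I"
  using assms by (induction I rule: finite_ne_induct) (simp_all add: nesum_insert)

definition IP_set :: "nat \<Rightarrow> 'a::ab_semigroup_add set \<Rightarrow> bool" where
  "IP_set r B \<longleftrightarrow>
     (\<exists>s :: nat \<Rightarrow> 'a. \<forall>\<alpha>. \<alpha> \<noteq> {} \<and> \<alpha> \<subseteq> {1..r} \<longrightarrow> nesum s \<alpha> \<in> B)"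

text \<open>
  The subscript in \<open>IP\<^sub>0\<close> is a name: this is not \<^term>\<open>IP_set 0\<close>, which holds of every set,
  so that it is immaterial whether \<open>r\<close> starts at 0 or 1 here.
\<close>

definition IP0_set :: "'a::ab_semigroup_add set \<Rightarrow> bool" where
  "IP0_set B \<longleftrightarrow> (\<forall>r. IP_set r B)"

definition left_quotient :: "'a::semigroup_mult set \<Rightarrow> 'a \<Rightarrow> 'a set \<Rightarrow> 'a set" where
  "left_quotient R r B = {t \<in> R. r * t \<in> B}"

text \<open>In the next two definitions \<open>B\<close> is meant to be a subset of \<open>R\<close>.\<close>

definition thick_in :: "'a::semigroup_mult set \<Rightarrow> 'a set \<Rightarrow> bool" where
  "thick_in R B \<longleftrightarrow>
     (\<forall>F. finite F \<and> F \<subseteq> R \<longrightarrow> (\<exists>x\<in>R. (\<lambda>f. f * x) ` F \<subseteq> B))"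

definition piecewise_syndetic_in :: "'a::semigroup_mult set \<Rightarrow> 'a set \<Rightarrow> bool" where
  "piecewise_syndetic_in R B \<longleftrightarrow>
     (\<exists>K. finite K \<and> K \<noteq> {} \<and> K \<subseteq> R \<and> thick_in R (\<Union>r\<in>K. left_quotient R r B))"

end

theory Submission
  imports Defs
begin

text \<open>
  Let \<open>r\<^sub>1\<^sup>-\<^sup>1A \<union> \<dots> \<union> r\<^sub>k\<^sup>-\<^sup>1A\<close> be thick. Since \<open>R\<close> contains all the sums of a sequence \<open>xs\<close> as long as we
  like, there is \<open>x\<close> such that every such sum \<open>y\<close> has a colour \<open>r\<^sub>i\<close> with \<open>r\<^sub>i y x \<in> A\<close>. By Folkman's
  theorem some long sequence \<open>ys\<close> of sums of disjoint blocks of \<open>xs\<close> has all its sums of a single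
  colour \<open>r\<^sub>i\<close>, and by distributivity the sums of the sequence \<open>r\<^sub>i y x\<close>, for \<open>y\<close> in \<open>ys\<close>, lie in \<open>A\<close>.

  Folkman's theorem itself is obtained from Hilbert's cube lemma: iterating the latter gives a
  sequence for which the colour of a sum depends only on its first summand, and then the pigeonhole
  principle applies.
\<close>

section \<open>Sums over nonempty sublists, and their link to \<open>nesum\<close>\<close>

text \<open>Leaving out the empty sublist makes a zero unnecessary. The sums are kept as a list with
  repetitions, so that a function on them can be recorded as a list whose length is known in
  advance.\<close>

fun subsums :: "'a::ab_semigroup_add list \<Rightarrow> 'a list" where
  "subsums [] = []"
| "subsums (x # xs) = x # subsums xs @ map ((+) x) (subsums xs)"

lemma length_subsums: "length (subsums xs) = 2 ^ length xs - 1"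
proof -
  have "Suc (length (subsums xs)) = 2 ^ length xs"
    by (induction xs) simp_all
  then show ?thesis by simp
qed

lemma set_subsums_append:
  "set (subsums (xs @ ys)) = set (subsums xs) \<union> set (subsums ys)
     \<union> (\<Union>a\<in>set (subsums xs). (+) a ` set (subsums ys))"
proof (induction xs)
  case (Cons x xs)
  have "(+) x ` (\<Union>a\<in>set (subsums xs). (+) a ` set (subsums ys))
      = (\<Union>a\<in>(+) x ` set (subsums xs). (+) a ` set (subsums ys))"
    by (simp add: image_UN image_image add.assoc)
  with Cons show ?case by (simp add: image_Un Un_ac)
qed simp

lemma subsums_map:
  assumes "\<And>a b. h (a + b) = h a + h b"
  shows "subsums (map h xs) = map h (subsums xs)"
  by (induction xs) (simp_all add: assms)

lemma set_subsums_filter: "set (subsums (filter P xs)) \<subseteq> set (subsums xs)"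
  by (induction xs) auto

text \<open>The nonempty subsets of \<open>set (i # is)\<close> are \<open>{i}\<close>, those
  avoiding \<open>i\<close>, and the latter with \<open>i\<close> inserted, just as in the recursion
  of \<open>subsums\<close>. Distinctness keeps \<open>i\<close> out of the tail, so that
  \<open>nesum_insert\<close> applies.\<close>

lemma set_subsums_map_nesum:
  assumes "distinct is"
  shows "set (subsums (map s is)) = nesum s ` {\<alpha>. \<alpha> \<noteq> {} \<and> \<alpha> \<subseteq> set is}"
  using assms
proof (induction "is")
  case (Cons i "is")
  let ?P = "{\<alpha>. \<alpha> \<noteq> {} \<and> \<alpha> \<subseteq> set is}"
  have "{\<alpha>. \<alpha> \<noteq> {} \<and> \<alpha> \<subseteq> set (i # is)} = insert {i} (?P \<union> insert i ` ?P)"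
    (is "?L = ?R")
  proof
    show "?L \<subseteq> ?R"
    proof
      fix \<alpha> assume \<alpha>: "\<alpha> \<in> ?L"
      show "\<alpha> \<in> ?R"
      proof (cases "i \<in> \<alpha>")
        case True
        then have "\<alpha> = insert i (\<alpha> - {i})" by blast
        moreover have "\<alpha> = {i} \<or> \<alpha> - {i} \<in> ?P" using \<alpha> by auto
        ultimately show ?thesis by blast
      qed (use \<alpha> in auto)
    qed
  qed auto
  moreover have "nesum s (insert i \<alpha>) = s i + nesum s \<alpha>" if "\<alpha> \<in> ?P" for \<alpha>
  proof (rule nesum_insert)
    show "finite \<alpha>" using that finite_subset[of \<alpha> "set is"] by simp
  qed (use that Cons.prems in auto)
  then have "nesum s ` insert i ` ?P = (+) (s i) ` nesum s ` ?P"
    unfolding image_image by (rule image_cong[OF refl])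
  ultimately show ?case
    using Cons by (simp add: image_Un)
qed simp

lemma IP_set_iff_subsums:
  "IP_set r B \<longleftrightarrow> (\<exists>xs. length xs = r \<and> set (subsums xs) \<subseteq> B)"
proof -
  have eq: "(\<forall>\<alpha>. \<alpha> \<noteq> {} \<and> \<alpha> \<subseteq> {1..r} \<longrightarrow> nesum s \<alpha> \<in> B)
      \<longleftrightarrow> set (subsums (map s [1..<Suc r])) \<subseteq> B" for s
    using set_subsums_map_nesum[of "[1..<Suc r]" s]
    by (auto simp: atLeastLessThanSuc_atLeastAtMost simp del: upt_Suc)
  \<comment> \<open>Indices in \<open>IP_set\<close> start at 1, positions in a list at 0.\<close>
  have "xs = map (\<lambda>i. xs ! (i - 1)) [1..<Suc (length xs)]" for xs :: "'a list"
    by (rule nth_equalityI) (simp_all del: upt_Suc)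
  then show ?thesis
    unfolding IP_set_def eq by (metis length_map length_upt diff_Suc_1)
qed

section \<open>Partial sums and Hilbert's cube lemma\<close>

fun prefix_sums :: "'a::ab_semigroup_add list \<Rightarrow> 'a list" where
  "prefix_sums [] = []"
| "prefix_sums (x # xs) = x # map ((+) x) (prefix_sums xs)"

lemma length_prefix_sums [simp]: "length (prefix_sums xs) = length xs"
  by (induction xs) simp_all

lemma set_prefix_sums: "set (prefix_sums xs) \<subseteq> set (subsums xs)"
  by (induction xs) auto

text \<open>A semigroup has no subtraction; the difference \<open>q\<close> is instead the sum of
  the entries after position \<open>i\<close> up to position \<open>j\<close>.\<close>

lemma prefix_sums_nth_less:
  assumes "i < j" "j < length xs"
  shows "\<exists>q \<in> set (subsums xs). prefix_sums xs ! j = prefix_sums xs ! i + q"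
  using assms
proof (induction xs arbitrary: i j)
  case (Cons x xs)
  from Cons.prems obtain j' where j: "j = Suc j'" by (cases j) auto
  show ?case
  proof (cases i)
    case 0
    have "prefix_sums xs ! j' \<in> set (subsums xs)"
      using Cons.prems j set_prefix_sums[of xs] by (auto intro!: subsetD[OF set_prefix_sums])
    with 0 j Cons.prems show ?thesis by auto
  next
    case (Suc i')
    with Cons.IH[of i' j'] Cons.prems j
    obtain q where "q \<in> set (subsums xs)" "prefix_sums xs ! j' = prefix_sums xs ! i' + q"
      by auto
    with Suc j Cons.prems show ?thesis by (auto simp: add.assoc)
  qed
qed simp

text \<open>There are more partial sums than colours, so two of them agree in colour;
  \<open>p\<close> is the shorter one and \<open>q\<close> the sum of the block between
  them.\<close>

lemma subsums_pigeonhole: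
  assumes "finite D" "f ` set (subsums xs) \<subseteq> D" "card D < length xs"
  obtains p q where "set (subsums [p, q]) \<subseteq> set (subsums xs)" "f p = f (p + q)"
proof -
  let ?l = "map f (prefix_sums xs)"
  have "set ?l \<subseteq> D" using assms(2) set_prefix_sums[of xs] by auto
  then have "card (set ?l) < length ?l"
    using card_mono[OF assms(1), of "set ?l"] assms(3) by simp
  then have "\<not> distinct ?l" using distinct_card[of ?l] by linarith
  then obtain i j where "i < length xs" "j < length xs" "i \<noteq> j"
    "f (prefix_sums xs ! i) = f (prefix_sums xs ! j)"
    by (auto simp: distinct_conv_nth)
  then obtain i j where ij: "i < j" "j < length xs"
    "f (prefix_sums xs ! i) = f (prefix_sums xs ! j)"
    by (cases i j rule: linorder_cases) auto
  from prefix_sums_nth_less[OF ij(1,2)] obtain q where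
    q: "q \<in> set (subsums xs)" "prefix_sums xs ! j = prefix_sums xs ! i + q" by blast
  have in_subsums: "prefix_sums xs ! n \<in> set (subsums xs)" if "n < length xs" for n
    using that set_prefix_sums[of xs] nth_mem[of n "prefix_sums xs"] by auto
  show thesis
  proof (rule that)
    show "set (subsums [prefix_sums xs ! i, q]) \<subseteq> set (subsums xs)"
      using in_subsums[of i] in_subsums[of j] q ij(1,2) by simp
    show "f (prefix_sums xs ! i) = f (prefix_sums xs ! i + q)"
      using ij(3) unfolding q(2) .
  qed
qed

text \<open>
  In the induction step the sums \<open>p\<close> of a long initial part of the sequence are coloured by the
  whole function \<open>y \<mapsto> c (p + y)\<close>, for \<open>y\<close> a sum of the remaining part.
\<close>

lemma hilbert_cube:
  fixes C :: "'c set"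
  assumes "finite C"
  shows "\<exists>N. \<forall>(xs :: 'a::ab_semigroup_add list) c :: 'a \<Rightarrow> 'c.
    length xs = N \<longrightarrow> c ` set (subsums xs) \<subseteq> C \<longrightarrow>
    (\<exists>d ys. length ys = m \<and> set (subsums (d # ys)) \<subseteq> set (subsums xs)
      \<and> (\<forall>y \<in> set (subsums ys). c (d + y) = c d))"
proof (induction m)
  case 0
  show ?case
  proof (intro exI[of _ 1] allI impI)
    fix xs :: "'a list" and c :: "'a \<Rightarrow> 'c"
    assume "length xs = 1"
    then obtain x where "xs = [x]" by (cases xs) auto
    then show "\<exists>d ys. length ys = 0 \<and> set (subsums (d # ys)) \<subseteq> set (subsums xs)
      \<and> (\<forall>y \<in> set (subsums ys). c (d + y) = c d)"
      by (intro exI[of _ x] exI[of _ "[]"]) simp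
  qed
next
  case (Suc m)
  then obtain N where N: "\<And>(xs :: 'a list) c :: 'a \<Rightarrow> 'c.
    length xs = N \<Longrightarrow> c ` set (subsums xs) \<subseteq> C \<Longrightarrow>
    (\<exists>d ys. length ys = m \<and> set (subsums (d # ys)) \<subseteq> set (subsums xs)
      \<and> (\<forall>y \<in> set (subsums ys). c (d + y) = c d))" by blast
  \<comment> \<open>These lists encode the functions from the sums of the last \<open>N\<close>
    entries to \<open>C\<close>. \<open>D\<close> depends only on \<open>C\<close> and
    \<open>N\<close>, so the length chosen below does not depend on \<open>xs\<close> or
    \<open>c\<close>.\<close>
  define D where "D = {l. set l \<subseteq> C \<and> length l = 2 ^ N - 1}"
  have "finite D" unfolding D_def using assms by (rule finite_lists_length_eq)
  show ?case
  proof (intro exI[of _ "Suc (card D) + N"] allI impI)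
    fix xs :: "'a list" and c :: "'a \<Rightarrow> 'c"
    assume len: "length xs = Suc (card D) + N" and col: "c ` set (subsums xs) \<subseteq> C"
    define us vs where "us = take (Suc (card D)) xs" and "vs = drop (Suc (card D)) xs"
    have xs: "xs = us @ vs" and us: "length us = Suc (card D)" and vs: "length vs = N"
      using len by (simp_all add: us_def vs_def)
    have vs_xs: "set (subsums vs) \<subseteq> set (subsums xs)"
      and us_xs: "set (subsums us) \<subseteq> set (subsums xs)"
      and us_vs_xs: "\<And>p y. p \<in> set (subsums us) \<Longrightarrow> y \<in> set (subsums vs)
            \<Longrightarrow> p + y \<in> set (subsums xs)"
      unfolding xs set_subsums_append by auto
    have col_add: "c (p + y) \<in> C"
      if "p \<in> set (subsums us)" "y \<in> set (subsums vs)" for p y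
      using us_vs_xs[OF that] col by blast
    then have "(\<lambda>p. map (\<lambda>y. c (p + y)) (subsums vs)) ` set (subsums us) \<subseteq> D"
      using vs by (auto simp: D_def length_subsums)
    from subsums_pigeonhole[OF \<open>finite D\<close> this, unfolded us, OF lessI]
    obtain p q where pq: "set (subsums [p, q]) \<subseteq> set (subsums us)"
      and eq: "map (\<lambda>y. c (p + y)) (subsums vs) = map (\<lambda>y. c (p + q + y)) (subsums vs)"
      by blast
    \<comment> \<open>The induction hypothesis is applied to the colouring translated by
      \<open>p\<close>.\<close>
    have "(\<lambda>y. c (p + y)) ` set (subsums vs) \<subseteq> C"
      using col_add[of p] pq by auto
    from N[OF vs this] obtain d ys where ys: "length ys = m"
      and sub: "set (subsums (d # ys)) \<subseteq> set (subsums vs)"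
      and const: "\<And>y. y \<in> set (subsums ys) \<Longrightarrow> c (p + (d + y)) = c (p + d)" by blast
    have shift: "c (p + q + y) = c (p + y)" if "y \<in> set (subsums (d # ys))" for y
      using eq that sub by auto
    have in_xs: "y \<in> set (subsums xs)" "p + y \<in> set (subsums xs)"
        "q + y \<in> set (subsums xs)" "p + q + y \<in> set (subsums xs)"
      if "y \<in> set (subsums (d # ys))" for y
    proof -
      have y: "y \<in> set (subsums vs)" using that sub by blast
      show "y \<in> set (subsums xs)" using y vs_xs by blast
      show "p + y \<in> set (subsums xs)" "q + y \<in> set (subsums xs)" "p + q + y \<in> set (subsums xs)"
        by (rule us_vs_xs[OF _ y], use pq in simp)+
    qed
    have "q \<in> set (subsums xs)" using pq us_xs by auto
    moreover have "p + d \<in> set (subsums xs)" "p + d + q \<in> set (subsums xs)"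
      using in_xs[of d] by (simp_all add: ac_simps)
    moreover have "y \<in> set (subsums xs)" "q + y \<in> set (subsums xs)"
        "p + d + y \<in> set (subsums xs)" "p + d + (q + y) \<in> set (subsums xs)"
      if "y \<in> set (subsums ys)" for y
      using in_xs[of y] in_xs[of "d + y"] that by (simp_all add: ac_simps)
    \<comment> \<open>The new cube has base \<open>p + d\<close>, and \<open>q\<close> is its
      additional generator.\<close>
    ultimately have "set (subsums ((p + d) # q # ys)) \<subseteq> set (subsums xs)"
      by auto
    moreover have "c (p + d + y) = c (p + d)" if "y \<in> set (subsums (q # ys))" for y
    proof -
      \<comment> \<open>\<open>shift\<close> removes \<open>q\<close> from a sum, and
        \<open>const\<close> removes what comes from \<open>ys\<close>.\<close>
      from that consider "y = q" | "y \<in> set (subsums ys)"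
        | z where "z \<in> set (subsums ys)" "y = q + z" by auto
      then show ?thesis
      proof cases
        case 1
        with shift[of d] show ?thesis by (simp add: ac_simps)
      next
        case 2
        with const[of y] show ?thesis by (simp add: ac_simps)
      next
        case 3
        with const[of z] shift[of "d + z"] show ?thesis by (simp add: ac_simps)
      qed
    qed
    ultimately show "\<exists>d ys. length ys = Suc m \<and> set (subsums (d # ys)) \<subseteq> set (subsums xs)
      \<and> (\<forall>y \<in> set (subsums ys). c (d + y) = c d)"
      using ys by (intro exI[of _ "p + d"] exI[of _ "q # ys"]) simp
  qed
qed

section \<open>From cubes to Folkman's theorem\<close>

fun colour_by_first :: "('a::ab_semigroup_add \<Rightarrow> 'c) \<Rightarrow> 'a list \<Rightarrow> bool" where
  "colour_by_first c [] \<longleftrightarrow> True"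
| "colour_by_first c (y # ys) \<longleftrightarrow>
     (\<forall>z \<in> set (subsums ys). c (y + z) = c y) \<and> colour_by_first c ys"

text \<open>The first summand of \<open>z\<close> is an entry of colour \<open>i\<close>, and it
  determines the colour of \<open>z\<close>.\<close>

lemma colour_by_first_filter:
  assumes "colour_by_first c ys" "z \<in> set (subsums (filter (\<lambda>y. c y = i) ys))"
  shows "c z = i"
  using assms
proof (induction ys arbitrary: z)
  case (Cons y ys)
  let ?F = "set (subsums (filter (\<lambda>y. c y = i) ys))"
  have IH: "c z = i" if "z \<in> ?F" for z
    using Cons.IH[OF _ that] Cons.prems(1) by simp
  have add: "c (y + z) = c y" if "z \<in> ?F" for z
    using set_subsums_filter that Cons.prems(1) by (metis colour_by_first.simps(2) subsetD)
  show ?case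
  proof (cases "c y = i")
    case True
    with Cons.prems(2) have "z = y \<or> z \<in> ?F \<or> z \<in> (+) y ` ?F" by simp
    with True show ?thesis using IH add by blast
  next
    case False
    with Cons.prems(2) show ?thesis by (intro IH) simp
  qed
qed simp

text \<open>A cube with base \<open>d\<close> and sufficiently many generators \<open>zs\<close> is
  found first. The induction hypothesis inside \<open>zs\<close> gives \<open>ys\<close>; its sums
  are among those of \<open>zs\<close>, so adding them still preserves the colour of
  \<open>d\<close>.\<close>

lemma exists_colour_by_first:
  fixes C :: "'c set"
  assumes "finite C"
  shows "\<exists>N. \<forall>(xs :: 'a::ab_semigroup_add list) c :: 'a \<Rightarrow> 'c.
    length xs = N \<longrightarrow> c ` set (subsums xs) \<subseteq> C \<longrightarrow>
    (\<exists>ys. length ys = r \<and> set (subsums ys) \<subseteq> set (subsums xs) \<and> colour_by_first c ys)"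
proof (induction r)
  case 0
  show ?case by (rule exI[of _ 0]) auto
next
  case (Suc r)
  then obtain m where m: "\<And>(xs :: 'a list) c :: 'a \<Rightarrow> 'c.
    length xs = m \<Longrightarrow> c ` set (subsums xs) \<subseteq> C \<Longrightarrow>
    (\<exists>ys. length ys = r \<and> set (subsums ys) \<subseteq> set (subsums xs) \<and> colour_by_first c ys)"
    by blast
  obtain N where N: "\<And>(xs :: 'a list) c :: 'a \<Rightarrow> 'c.
    length xs = N \<Longrightarrow> c ` set (subsums xs) \<subseteq> C \<Longrightarrow>
    (\<exists>d ys. length ys = m \<and> set (subsums (d # ys)) \<subseteq> set (subsums xs)
      \<and> (\<forall>y \<in> set (subsums ys). c (d + y) = c d))"
    using hilbert_cube[OF assms, of m] by blast
  show ?case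
  proof (intro exI[of _ N] allI impI)
    fix xs :: "'a list" and c :: "'a \<Rightarrow> 'c"
    assume "length xs = N" and col: "c ` set (subsums xs) \<subseteq> C"
    from N[OF this] obtain d zs where zs: "length zs = m"
      "set (subsums (d # zs)) \<subseteq> set (subsums xs)"
      "\<forall>y \<in> set (subsums zs). c (d + y) = c d" by blast
    from zs(2) col have "c ` set (subsums zs) \<subseteq> C" by auto
    from m[OF zs(1) this] obtain ys where "length ys = r"
      "set (subsums ys) \<subseteq> set (subsums zs)" "colour_by_first c ys" by blast
    moreover from this(2) have "set (subsums (d # ys)) \<subseteq> set (subsums (d # zs))"
      by auto
    ultimately show "\<exists>ys. length ys = Suc r \<and> set (subsums ys) \<subseteq> set (subsums xs)
        \<and> colour_by_first c ys"
      using zs(2,3) by (intro exI[of _ "d # ys"] conjI) (simp, blast, auto)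
  qed
qed

lemma length_eq_sum_filter:
  assumes "finite C" "c ` set ys \<subseteq> C"
  shows "length ys = (\<Sum>i\<in>C. length (filter (\<lambda>y. c y = i) ys))"
  using assms(2)
proof (induction ys)
  case (Cons y ys)
  have "length (filter (\<lambda>y. c y = i) (y # ys))
      = (if c y = i then 1 else 0) + length (filter (\<lambda>y. c y = i) ys)" for i by simp
  with Cons assms(1) show ?case by (simp add: sum.distrib del: filter.simps)
qed simp

lemma subset_set_subsums: "set xs \<subseteq> set (subsums xs)"
  by (induction xs) auto

text \<open>Among \<open>Suc (card C * r)\<close> entries some colour occurs more than
  \<open>r\<close> times; all sums of the entries of that colour share it.\<close>

theorem folkman:
  fixes C :: "'c set"
  assumes "finite C"
  shows "\<exists>N. \<forall>(xs :: 'a::ab_semigroup_add list) c :: 'a \<Rightarrow> 'c.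
    length xs = N \<longrightarrow> c ` set (subsums xs) \<subseteq> C \<longrightarrow>
    (\<exists>ys i. length ys = r \<and> set (subsums ys) \<subseteq> set (subsums xs)
      \<and> (\<forall>z \<in> set (subsums ys). c z = i))"
proof -
  obtain N where N: "\<And>(xs :: 'a list) c :: 'a \<Rightarrow> 'c.
    length xs = N \<Longrightarrow> c ` set (subsums xs) \<subseteq> C \<Longrightarrow>
    (\<exists>ys. length ys = Suc (card C * r) \<and> set (subsums ys) \<subseteq> set (subsums xs)
      \<and> colour_by_first c ys)"
    using exists_colour_by_first[OF assms, of "Suc (card C * r)"] by blast
  show ?thesis
  proof (intro exI[of _ N] allI impI)
    fix xs :: "'a list" and c :: "'a \<Rightarrow> 'c"
    assume "length xs = N" and col: "c ` set (subsums xs) \<subseteq> C"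
    from N[OF this] obtain ys where ys: "length ys = Suc (card C * r)"
      "set (subsums ys) \<subseteq> set (subsums xs)" "colour_by_first c ys" by blast
    let ?f = "\<lambda>i. filter (\<lambda>y. c y = i) ys"
    have "c ` set ys \<subseteq> C" using subset_set_subsums[of ys] ys(2) col by blast
    then have "(\<Sum>i\<in>C. length (?f i)) = Suc (card C * r)"
      using length_eq_sum_filter[OF assms] ys(1) by metis
    then have "\<not> (\<forall>i\<in>C. length (?f i) \<le> r)"
      using sum_bounded_above[of C "\<lambda>i. length (?f i)" r] by fastforce
    then obtain i where i: "r < length (?f i)" by (auto simp: not_le)
    have "set (subsums (take r (?f i))) \<subseteq> set (subsums (?f i))"
      using set_subsums_append[of "take r (?f i)" "drop r (?f i)"] by auto
    then have *: "set (subsums (take r (?f i))) \<subseteq> set (subsums ys)"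
        "\<And>z. z \<in> set (subsums (take r (?f i))) \<Longrightarrow> c z = i"
      using set_subsums_filter colour_by_first_filter[OF ys(3)] by blast+
    show "\<exists>ys i. length ys = r \<and> set (subsums ys) \<subseteq> set (subsums xs)
        \<and> (\<forall>z \<in> set (subsums ys). c z = i)"
    proof (intro exI conjI ballI)
      show "length (take r (?f i)) = r" using i by simp
      show "set (subsums (take r (?f i))) \<subseteq> set (subsums xs)" using *(1) ys(2) by blast
    qed (rule *(2))
  qed
qed

section \<open>Transfer of finite sums into a piecewise syndetic set\<close>

theorem theorem7p1:
  fixes R A :: "'a::semiring set"
  assumes "\<And>x y. x \<in> R \<Longrightarrow> y \<in> R \<Longrightarrow> x * y \<in> R"
    and "IP0_set R"
    and "A \<subseteq> R"
    and "piecewise_syndetic_in R A"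
  shows "IP0_set A"
  unfolding IP0_set_def
proof
  fix r
  obtain K where K: "finite K" and thick: "thick_in R (\<Union>k\<in>K. left_quotient R k A)"
    using assms(4) unfolding piecewise_syndetic_in_def by blast
  \<comment> \<open>The colours are the elements of \<open>K\<close>, and \<open>N\<close> is fixed
    before a sequence in \<open>R\<close> is chosen.\<close>
  obtain N where N: "\<And>(xs :: 'a list) c :: 'a \<Rightarrow> 'a.
    length xs = N \<Longrightarrow> c ` set (subsums xs) \<subseteq> K \<Longrightarrow>
    (\<exists>ys i. length ys = r \<and> set (subsums ys) \<subseteq> set (subsums xs)
      \<and> (\<forall>z \<in> set (subsums ys). c z = i))"
    using folkman[OF K, of r] by blast
  obtain xs where xs: "length xs = N" "set (subsums xs) \<subseteq> R"
    using assms(2) unfolding IP0_set_def IP_set_iff_subsums by blast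
  from thick xs(2) obtain x where
    "(\<lambda>y. y * x) ` set (subsums xs) \<subseteq> (\<Union>k\<in>K. left_quotient R k A)"
    unfolding thick_in_def by (meson finite_set)
  then have "\<forall>y \<in> set (subsums xs). \<exists>k\<in>K. k * (y * x) \<in> A"
    unfolding left_quotient_def by blast
  then obtain c where c: "\<And>y. y \<in> set (subsums xs) \<Longrightarrow> c y \<in> K \<and> c y * (y * x) \<in> A"
    by metis
  then have "c ` set (subsums xs) \<subseteq> K" by blast
  from N[OF xs(1) this] obtain ys i where ys: "length ys = r"
    "set (subsums ys) \<subseteq> set (subsums xs)" "\<And>z. z \<in> set (subsums ys) \<Longrightarrow> c z = i" by blast
  \<comment> \<open>Multiplication by \<open>i\<close> on the left and by \<open>x\<close> on the
    right is additive, by the two distributive laws.\<close>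
  have "subsums (map (\<lambda>y. i * (y * x)) ys) = map (\<lambda>y. i * (y * x)) (subsums ys)"
    by (rule subsums_map) (simp add: distrib_left distrib_right)
  then have "set (subsums (map (\<lambda>y. i * (y * x)) ys)) \<subseteq> A"
    using c ys(2,3) by force
  with ys(1) show "IP_set r A"
    unfolding IP_set_iff_subsums by (metis length_map)
qed

end
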